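(* Let $k\ge 3$ and let $(G,\mathsf{X}_k)$ be a $k$-peg Hanoi group generated by $S$. Then $G$ is contracting if and only if the following condition holds: for any subset $T=\{s_i\}_{i=1}^M\subset S$ with nonempty essential set and any $j\in\mathsf{X}_k$ with $j\notin\operatorname{Fix}(T)$, there exists some $i\in\{1,\dots,M\}$ such that $\operatorname{Orb}_T(j)\cap Q_i=\emptyset$, where $Q_i$ is the set of inactive pegs of $s_i$.
   Context: Let $\mathsf{X}$ be a finite alphabet and $\mathsf{X}^*$ the set of finite words over $\mathsf{X}$, viewed as a rooted tree; $\operatorname{Aut}\mathsf{X}^*$ is the group of permutations of $\mathsf{X}^*$ preserving word length and common prefixes. For $g\in\operatorname{Aut}\mathsf{X}^*$, the root permutation $\sigma_g\in\operatorname{Sym}(\mathsf{X})$ is the restriction of $g$ to one-letter words, and for $x\in\mathsf{X}$ the section $g|_x\in\operatorname{Aut}\mathsf{X}^*$ is defined by $g(xw)=\sigma_g(x)\,g|_x(w)$ for all $w\in\mathsf{X}^*$. For $w=x_n\ldots x_1$ set $g|_w=(g|_{x_n})|_{x_{n-1}\ldots x_1}$ inductively. A self-similar group $(G,\mathsf{X})$ is a subgroup $G\le\operatorname{Aut}\mathsf{X}^*$ with $g|_x\in G$ for all $g\in G$, $x\in\mathsf{X}$. It is contracting if there is a finite set $\mathcal{N}\subset G$ such that for every $g\in G$ there is $n\in\mathbb{N}$ with $g|_v\in\mathcal{N}$ for all words $v$ with $|v|\ge n$. Let $\mathsf{X}_k=\{0,\dots,k-1\}$. A $k$-peg Hanoi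 automorphism is an $a\in\operatorname{Aut}\mathsf{X}_k^*$ for which there are disjoint sets $P_a,Q_a$ with $P_a\cup Q_a=\mathsf{X}_k$, $a|_i=1$ for $i\in P_a$, $a|_j=a$ for $j\in Q_a$, and $\sigma_a$ fixing every element of $Q_a$. For $a\ne1$ these sets are unique; $P_a$ is the set of active pegs and $Q_a$ the set of inactive pegs. The set of inactive pegs of the identity is defined to be $\mathsf{X}_k$. Let $S_k$ be the set of all $k$-peg Hanoi automorphisms. A $k$-peg Hanoi group $(G,\mathsf{X}_k)$ is a group $G\le \operatorname{Aut}\mathsf{X}_k^*$ together with a fixed generating set $S\subset S_k$, $1\in S$, that is state-closed (contains all sections of its elements). For a subset $T=\{s_i\}_{i=1}^M\subset S$, let $Q_i$ be the set of inactive pegs and $\sigma_i$ the root permutation of $s_i$. The essential set of $T$ is $\bigcap_{i=1}^M Q_i$. $\operatorname{Fix}(T)$ is the set of elements of $\mathsf{X}_k$ fixed by every $\sigma_i$, and $\operatorname{Orb}_T(j)$ is the orbit of $j\in\mathsf{X}_k$ under the subgroup of $\operatorname{Sym}(\mathsf{X}_k)$ generated by $\sigma_1,\dots,\sigma_M$. *)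

theory Defs
  imports "HOL-Algebra.Bij" "HOL-Algebra.Generated_Groups" "HOL-Algebra.Group_Action"
    "HOL-Library.Sublist"
begin

section \<open>Automorphisms of the tree of words\<close>

text \<open>
  Words over the alphabet \<open>X\<close> are the elements of \<open>lists X\<close>; the first letter of a list is the
  letter read first. As in \<^theory>\<open>HOL-Algebra.Bij\<close>, permutations of a set are extensional, so that
  equality of maps is equality on that set.
\<close>

definition tree_aut :: "'a set \<Rightarrow> ('a list \<Rightarrow> 'a list) set" where
  "tree_aut X = {g \<in> Bij (lists X).
     (\<forall>w\<in>lists X. length (g w) = length w) \<and>
     (\<forall>u\<in>lists X. \<forall>v\<in>lists X.
        longest_common_prefix (g u) (g v) = g (longest_common_prefix u v))}"

definition Aut_tree :: "'a set \<Rightarrow> ('a list \<Rightarrow> 'a list) monoid" where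
  "Aut_tree X = (BijGroup (lists X))\<lparr>carrier := tree_aut X\<rparr>"

definition root_perm :: "'a set \<Rightarrow> ('a list \<Rightarrow> 'a list) \<Rightarrow> 'a \<Rightarrow> 'a" where
  "root_perm X g = (\<lambda>x\<in>X. hd (g [x]))"

text \<open>The defining equation \<open>g (x # w) = \<sigma>\<^sub>g x # g|\<^sub>x w\<close> is proved as \<open>tree_aut_Cons\<close> below.\<close>

definition letter_section :: "'a set \<Rightarrow> ('a list \<Rightarrow> 'a list) \<Rightarrow> 'a \<Rightarrow> 'a list \<Rightarrow> 'a list" where
  "letter_section X g x = (\<lambda>w\<in>lists X. tl (g (x # w)))"

primrec word_section :: "'a set \<Rightarrow> ('a list \<Rightarrow> 'a list) \<Rightarrow> 'a list \<Rightarrow> 'a list \<Rightarrow> 'a list" where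
  "word_section X g [] = g"
| "word_section X g (x # w) = word_section X (letter_section X g x) w"

definition self_similar_group :: "'a set \<Rightarrow> ('a list \<Rightarrow> 'a list) set \<Rightarrow> bool" where
  "self_similar_group X G \<longleftrightarrow>
     finite X \<and> subgroup G (Aut_tree X) \<and> (\<forall>g\<in>G. \<forall>x\<in>X. letter_section X g x \<in> G)"

definition contracting :: "'a set \<Rightarrow> ('a list \<Rightarrow> 'a list) set \<Rightarrow> bool" where
  "contracting X G \<longleftrightarrow> self_similar_group X G \<and>
     (\<exists>N. finite N \<and> N \<subseteq> G \<and>
        (\<forall>g\<in>G. \<exists>n. \<forall>v\<in>lists X. n \<le> length v \<longrightarrow> word_section X g v \<in> N))"

lemma tree_aut_prefix:
  assumes "g \<in> tree_aut X" "u \<in> lists X" "v \<in> lists X" "prefix u v"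
  shows "prefix (g u) (g v)"
proof -
  have "longest_common_prefix u v = u"
    using assms(4) by (meson longest_common_prefix_max_prefix longest_common_prefix_prefix1
        prefix_order.order_antisym prefix_order.order_refl)
  then have "longest_common_prefix (g u) (g v) = g u"
    using assms by (auto simp: tree_aut_def)
  then show ?thesis
    by (metis longest_common_prefix_prefix2)
qed

lemma tree_aut_length: "g \<in> tree_aut X \<Longrightarrow> w \<in> lists X \<Longrightarrow> length (g w) = length w"
  by (simp add: tree_aut_def)

lemma tree_aut_mem: "g \<in> tree_aut X \<Longrightarrow> w \<in> lists X \<Longrightarrow> g w \<in> lists X"
  by (auto simp: tree_aut_def dest!: Bij_imp_funcset)

lemma tree_aut_Cons:
  assumes g: "g \<in> tree_aut X" and x: "x \<in> X" and w: "w \<in> lists X"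
  shows "g (x # w) = root_perm X g x # letter_section X g x w"
proof -
  have "prefix (g [x]) (g (x # w))"
    using tree_aut_prefix[OF g, of "[x]" "x # w"] x w by simp
  moreover have "length (g [x]) = 1"
    using tree_aut_length[OF g, of "[x]"] x by simp
  then obtain y where "g [x] = [y]"
    by (auto simp: length_Suc_conv)
  ultimately show ?thesis
    using x w by (cases "g (x # w)") (auto simp: root_perm_def letter_section_def)
qed

lemma subgroup_tree_aut: "subgroup (tree_aut X) (BijGroup (lists X))"
proof -
  interpret B: group "BijGroup (lists X)" by (rule group_BijGroup)
  have lcp: "longest_common_prefix u v \<in> lists X" if "u \<in> lists X" for u v :: "'a list"
    using that longest_common_prefix_prefix1[of u v] set_mono_prefix by fastforce
  have mulin: "compose (lists X) g h \<in> tree_aut X"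
    if "g \<in> tree_aut X" "h \<in> tree_aut X" for g h
  proof -
    have "compose (lists X) g h \<in> Bij (lists X)"
      using that by (auto simp: tree_aut_def intro: compose_Bij)
    moreover have "h w \<in> lists X" if "w \<in> lists X" for w
      using tree_aut_mem[OF \<open>h \<in> _\<close> that] .
    ultimately show ?thesis
      using that lcp by (auto simp add: tree_aut_def compose_def)
  qed
  have inv_in: "(\<lambda>x\<in>lists X. inv_into (lists X) g x) \<in> tree_aut X" if g: "g \<in> tree_aut X" for g
  proof -
    let ?i = "inv_into (lists X) g"
    have gB: "g \<in> Bij (lists X)" and bij: "bij_betw g (lists X) (lists X)"
      using g by (auto simp: tree_aut_def Bij_def)
    have im: "?i w \<in> lists X" if "w \<in> lists X" for w
      using Bij_inv_into_mem[OF gB that] .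
    have gi: "g (?i w) = w" if "w \<in> lists X" for w
      using bij that by (rule bij_betw_inv_into_right)
    have ig: "?i (g w) = w" if "w \<in> lists X" for w
      using bij that by (rule bij_betw_inv_into_left)
    have len: "length (?i w) = length w" if "w \<in> lists X" for w
      using tree_aut_length[OF g im[OF that]] gi[OF that] by simp
    have pre: "longest_common_prefix (?i u) (?i v) = ?i (longest_common_prefix u v)"
      if u: "u \<in> lists X" and v: "v \<in> lists X" for u v
    proof -
      have "longest_common_prefix (g (?i u)) (g (?i v)) = g (longest_common_prefix (?i u) (?i v))"
        using g im[OF u] im[OF v] unfolding tree_aut_def by blast
      then have "longest_common_prefix u v = g (longest_common_prefix (?i u) (?i v))"
        by (simp only: gi[OF u] gi[OF v])
      then show ?thesis
        using ig[OF lcp[OF im[OF u]]] by simp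
    qed
    show ?thesis
      unfolding tree_aut_def
      using restrict_inv_into_Bij[OF gB] len pre lcp by simp
  qed
  show ?thesis
  proof (rule B.subgroupI)
    show "tree_aut X \<subseteq> carrier (BijGroup (lists X))"
      by (auto simp: tree_aut_def BijGroup_def)
    have "(\<lambda>x\<in>lists X. x) \<in> tree_aut X"
      using lcp by (auto simp: tree_aut_def id_Bij)
    then show "tree_aut X \<noteq> {}" by blast
  next
    fix g assume g: "g \<in> tree_aut X"
    then show "inv\<^bsub>BijGroup (lists X)\<^esub> g \<in> tree_aut X"
      using inv_in[OF g] by (simp add: tree_aut_def inv_BijGroup)
  next
    fix g h assume "g \<in> tree_aut X" "h \<in> tree_aut X"
    then show "g \<otimes>\<^bsub>BijGroup (lists X)\<^esub> h \<in> tree_aut X"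
      using mulin[of g h] by (simp add: BijGroup_def tree_aut_def)
  qed
qed

lemma group_Aut_tree: "group (Aut_tree X)"
  unfolding Aut_tree_def by (rule subgroup.subgroup_is_group[OF subgroup_tree_aut group_BijGroup])


section \<open>Hanoi groups\<close>

definition hanoi_partition :: "nat \<Rightarrow> (nat list \<Rightarrow> nat list) \<Rightarrow> nat set \<Rightarrow> nat set \<Rightarrow> bool" where
  "hanoi_partition k a P Q \<longleftrightarrow>
     P \<inter> Q = {} \<and> P \<union> Q = {..<k} \<and>
     (\<forall>i\<in>P. letter_section {..<k} a i = \<one>\<^bsub>Aut_tree {..<k}\<^esub>) \<and>
     (\<forall>j\<in>Q. letter_section {..<k} a j = a) \<and>
     (\<forall>j\<in>Q. root_perm {..<k} a j = j)"

definition hanoi_automorphisms :: "nat \<Rightarrow> (nat list \<Rightarrow> nat list) set" where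
  "hanoi_automorphisms k = {a \<in> tree_aut {..<k}. \<exists>P Q. hanoi_partition k a P Q}"

text \<open>For the identity every partition into two parts is admissible; the convention is that all
  pegs are inactive.\<close>

definition inactive_pegs :: "nat \<Rightarrow> (nat list \<Rightarrow> nat list) \<Rightarrow> nat set" where
  "inactive_pegs k a =
     (if a = \<one>\<^bsub>Aut_tree {..<k}\<^esub> then {..<k} else (THE Q. \<exists>P. hanoi_partition k a P Q))"

lemma hanoi_partition_inactive_pegs:
  assumes a: "a \<noteq> \<one>\<^bsub>Aut_tree {..<k}\<^esub>" and pq: "hanoi_partition k a P Q"
  shows "inactive_pegs k a = Q"
proof -
  have uniq: "Q' = {j\<in>{..<k}. letter_section {..<k} a j = a}" if "hanoi_partition k a P' Q'" for P' Q'
  proof -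
    have "j \<in> Q' \<longleftrightarrow> j \<in> {j\<in>{..<k}. letter_section {..<k} a j = a}" for j
    proof (cases "j \<in> Q'")
      case True
      then show ?thesis using that unfolding hanoi_partition_def by blast
    next
      case False
      have "letter_section {..<k} a j = \<one>\<^bsub>Aut_tree {..<k}\<^esub>" if "j \<in> {..<k}"
        using that False \<open>hanoi_partition k a P' Q'\<close> unfolding hanoi_partition_def by blast
      then show ?thesis using a False by auto
    qed
    then show ?thesis by blast
  qed
  have "(THE Q. \<exists>P. hanoi_partition k a P Q) = Q"
    using pq uniq by (intro the_equality) blast+
  then show ?thesis using a by (simp add: inactive_pegs_def)
qed

definition hanoi_group ::
  "nat \<Rightarrow> (nat list \<Rightarrow> nat list) set \<Rightarrow> (nat list \<Rightarrow> nat list) set \<Rightarrow> bool" where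
  "hanoi_group k G S \<longleftrightarrow>
     subgroup G (Aut_tree {..<k}) \<and>
     S \<subseteq> hanoi_automorphisms k \<and> \<one>\<^bsub>Aut_tree {..<k}\<^esub> \<in> S \<and>
     (\<forall>s\<in>S. \<forall>x<k. letter_section {..<k} s x \<in> S) \<and>
     generate (Aut_tree {..<k}) S = G"

text \<open>Intersecting with \<open>{..<k}\<close> only matters for \<open>T = {}\<close>.\<close>

definition essential_set :: "nat \<Rightarrow> (nat list \<Rightarrow> nat list) set \<Rightarrow> nat set" where
  "essential_set k T = {..<k} \<inter> (\<Inter>s\<in>T. inactive_pegs k s)"

definition fixed_pegs :: "nat \<Rightarrow> (nat list \<Rightarrow> nat list) set \<Rightarrow> nat set" where
  "fixed_pegs k T = {x\<in>{..<k}. \<forall>s\<in>T. root_perm {..<k} s x = x}"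

definition peg_orbit :: "nat \<Rightarrow> (nat list \<Rightarrow> nat list) set \<Rightarrow> nat \<Rightarrow> nat set" where
  "peg_orbit k T j =
     orbit ((BijGroup {..<k})\<lparr>carrier := generate (BijGroup {..<k}) (root_perm {..<k} ` T)\<rparr>)
       (\<lambda>p. p) j"

end

theory Submission
  imports Defs
begin

text \<open>
  Contraction is equivalent to the finiteness of the group generated by \<open>T\<close> for every \<open>T \<subseteq> S\<close> with
  a common inactive peg \<open>e\<close>. Such a group reproduces itself below \<open>e\<close>: each of its elements equals its
  own section at \<open>e\<close>, hence at all powers of \<open>e\<close>, and so lies in any finite set that eventually absorbs
  sections (\<open>finite_generate_of_contracting\<close>). Conversely, consider the section of a word of generators
  at a letter. Each generator contributes itself, if the peg it meets is inactive, or the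
  identity. So the word gets shorter, unless the letter is inactive for all generators in it, and
  then the product belongs to one of finitely many finite groups closed under sections. Their union
  is the nucleus (\<open>contracting_of_finite_generate\<close>).

  It remains to match finiteness with the condition on orbits.

  If the orbit of a moved peg \<open>j\<close> contains an inactive peg of every generator, then every element of
  the group is the section at \<open>j\<close> of some element of the stabilizer of \<open>j\<close>
  (\<open>stabilizer_section_onto\<close>): a generator that moves a peg has trivial section there, so one can
  travel through the orbit without changing the section. As \<open>j\<close> is moved, the stabilizer is a proper
  subgroup that maps onto the whole group, which is therefore infinite
  (\<open>orbit_avoids_inactive_pegs_of_finite_generate\<close>).

  If for every moved peg some generator is active on the whole orbit, then that generator does not
  enter the sections along this orbit. Nor does a generator enter the sections at a fixed peg where
  it is active. Hence all sections at pegs outside the essential set lie in groups with fewer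
  generators, and finiteness follows by induction on the generating set
  (\<open>finite_generate_of_orbit_condition\<close>).
\<close>

section \<open>Root permutations and sections of tree automorphisms\<close>

interpretation Aut: group "Aut_tree X" for X :: "'a set"
  by (rule group_Aut_tree)

lemma carrier_Aut_tree: "carrier (Aut_tree X) = tree_aut X"
  by (simp add: Aut_tree_def)

lemma one_Aut_tree: "\<one>\<^bsub>Aut_tree X\<^esub> = (\<lambda>w\<in>lists X. w)"
  by (simp add: Aut_tree_def BijGroup_def)

lemma tree_aut_Bij: "g \<in> tree_aut X \<Longrightarrow> g \<in> Bij (lists X)"
  by (simp add: tree_aut_def)

lemma tree_aut_inj: "g \<in> tree_aut X \<Longrightarrow> inj_on g (lists X)"
  by (auto simp: tree_aut_def Bij_def bij_betw_def)

lemma tree_aut_surj: "g \<in> tree_aut X \<Longrightarrow> g ` lists X = lists X"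
  by (auto simp: tree_aut_def Bij_def bij_betw_def)

lemma tree_aut_Nil: "g \<in> tree_aut X \<Longrightarrow> g [] = []"
  using tree_aut_length[of g X "[]"] by simp

lemma mult_Aut_tree:
  assumes "g \<in> tree_aut X" "h \<in> tree_aut X"
  shows "g \<otimes>\<^bsub>Aut_tree X\<^esub> h = compose (lists X) g h"
  using assms by (simp add: Aut_tree_def BijGroup_def tree_aut_Bij)

lemma mult_Aut_tree_apply:
  assumes "g \<in> tree_aut X" "h \<in> tree_aut X" "w \<in> lists X"
  shows "(g \<otimes>\<^bsub>Aut_tree X\<^esub> h) w = g (h w)"
  using assms by (simp add: mult_Aut_tree compose_def)

lemma root_perm_mem:
  assumes g: "g \<in> tree_aut X" and x: "x \<in> X"
  shows "root_perm X g x \<in> X"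
  using tree_aut_mem[OF g, of "[x]"] tree_aut_Cons[OF g x, of "[]"] x by simp

lemma letter_section_word_mem:
  assumes g: "g \<in> tree_aut X" and x: "x \<in> X" and w: "w \<in> lists X"
  shows "letter_section X g x w \<in> lists X"
  using tree_aut_mem[OF g, of "x # w"] tree_aut_Cons[OF g x w] x w by simp

lemma root_perm_Bij:
  assumes g: "g \<in> tree_aut X"
  shows "root_perm X g \<in> Bij X"
proof -
  have single: "g [x] = [root_perm X g x]" if "x \<in> X" for x
    using tree_aut_Cons[OF g that, of "[]"] tree_aut_length[OF g, of "[x]"] that by simp
  have inj: "inj_on (root_perm X g) X"
  proof (rule inj_onI)
    fix x y assume xy: "x \<in> X" "y \<in> X" "root_perm X g x = root_perm X g y"
    then have "g [x] = g [y]" by (simp add: single)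
    then show "x = y" using inj_onD[OF tree_aut_inj[OF g]] xy by fastforce
  qed
  have "X \<subseteq> root_perm X g ` X"
  proof
    fix y assume "y \<in> X"
    then have "[y] \<in> g ` lists X" by (simp add: tree_aut_surj[OF g])
    then obtain u where u: "u \<in> lists X" "[y] = g u" by blast
    then have "length u = 1" using tree_aut_length[OF g u(1)] u(2)[symmetric] by simp
    then obtain x where "u = [x]" by (auto simp: length_Suc_conv)
    then show "y \<in> root_perm X g ` X" using u single by auto
  qed
  then have "root_perm X g ` X = X"
    using root_perm_mem[OF g] by blast
  with inj show ?thesis
    by (simp add: Bij_def bij_betw_def root_perm_def)
qed

lemma root_perm_PiE: "g \<in> tree_aut X \<Longrightarrow> root_perm X g \<in> X \<rightarrow>\<^sub>E X"
  using root_perm_Bij[of g X] by (auto simp: Bij_def PiE_def bij_betw_def)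

lemma letter_section_tree_aut:
  assumes g: "g \<in> tree_aut X" and x: "x \<in> X"
  shows "letter_section X g x \<in> tree_aut X"
proof -
  let ?s = "letter_section X g x"
  note Cons = tree_aut_Cons[OF g x]
  have lcp: "longest_common_prefix u v \<in> lists X" if "u \<in> lists X" for u v :: "'a list"
    using that longest_common_prefix_prefix1[of u v] set_mono_prefix by fastforce
  have inj: "inj_on ?s (lists X)"
  proof (rule inj_onI)
    fix u v assume uv: "u \<in> lists X" "v \<in> lists X" "?s u = ?s v"
    then have "g (x # u) = g (x # v)" by (simp add: Cons)
    then show "u = v" using inj_onD[OF tree_aut_inj[OF g]] uv x by fastforce
  qed
  have "lists X \<subseteq> ?s ` lists X"
  proof
    fix w assume w: "w \<in> lists X"
    then have "root_perm X g x # w \<in> g ` lists X"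
      using root_perm_mem[OF g x] by (simp add: tree_aut_surj[OF g])
    then obtain u where u: "u \<in> lists X" "root_perm X g x # w = g u" by blast
    then obtain y u' where yu: "u = y # u'" "y \<in> X" "u' \<in> lists X"
      using tree_aut_Nil[OF g] by (cases u) auto
    then have eq: "root_perm X g x = root_perm X g y" "w = letter_section X g y u'"
      using u tree_aut_Cons[OF g] by simp_all
    have "x = y"
      using root_perm_Bij[OF g] eq(1) x yu(2) by (auto simp: Bij_def bij_betw_def inj_on_def)
    then show "w \<in> ?s ` lists X" using eq yu by blast
  qed
  moreover have "?s ` lists X \<subseteq> lists X"
    using letter_section_word_mem[OF g x] by blast
  ultimately have "?s \<in> Bij (lists X)"
    using inj by (auto simp: Bij_def bij_betw_def letter_section_def)
  moreover have "length (?s w) = length w" if "w \<in> lists X" for w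
    using tree_aut_length[OF g, of "x # w"] that x by (simp add: Cons)
  moreover have "longest_common_prefix (?s u) (?s v) = ?s (longest_common_prefix u v)"
    if "u \<in> lists X" "v \<in> lists X" for u v
  proof -
    have "longest_common_prefix (g (x # u)) (g (x # v)) = g (longest_common_prefix (x # u) (x # v))"
      using g x that unfolding tree_aut_def by auto
    then show ?thesis using that lcp by (simp add: Cons)
  qed
  ultimately show ?thesis by (simp add: tree_aut_def)
qed

lemma root_perm_one: "x \<in> X \<Longrightarrow> root_perm X \<one>\<^bsub>Aut_tree X\<^esub> x = x"
  by (simp add: one_Aut_tree root_perm_def)

lemma letter_section_one:
  "x \<in> X \<Longrightarrow> letter_section X \<one>\<^bsub>Aut_tree X\<^esub> x = \<one>\<^bsub>Aut_tree X\<^esub>"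
  by (auto simp: one_Aut_tree letter_section_def)

lemma root_perm_mult:
  assumes g: "g \<in> tree_aut X" and h: "h \<in> tree_aut X" and x: "x \<in> X"
  shows "root_perm X (g \<otimes>\<^bsub>Aut_tree X\<^esub> h) x = root_perm X g (root_perm X h x)"
proof -
  have "hd (g (h [x])) = root_perm X g (root_perm X h x)"
    using tree_aut_Cons[OF h x, of "[]"] tree_aut_Cons[OF g root_perm_mem[OF h x]]
      letter_section_word_mem[OF h x, of "[]"] by simp
  then show ?thesis
    using x by (simp add: mult_Aut_tree_apply[OF g h] root_perm_def[of X "g \<otimes>\<^bsub>Aut_tree X\<^esub> h"])
qed

lemma letter_section_mult:
  assumes g: "g \<in> tree_aut X" and h: "h \<in> tree_aut X" and x: "x \<in> X"
  shows "letter_section X (g \<otimes>\<^bsub>Aut_tree X\<^esub> h) x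
    = letter_section X g (root_perm X h x) \<otimes>\<^bsub>Aut_tree X\<^esub> letter_section X h x"
proof -
  have y: "root_perm X h x \<in> X" using root_perm_mem[OF h x] .
  have "letter_section X (g \<otimes>\<^bsub>Aut_tree X\<^esub> h) x w
      = compose (lists X) (letter_section X g (root_perm X h x)) (letter_section X h x) w" for w
  proof (cases "w \<in> lists X")
    case True
    then show ?thesis
      using x tree_aut_Cons[OF h x True] letter_section_word_mem[OF h x True]
        tree_aut_Cons[OF g y letter_section_word_mem[OF h x True]]
      by (simp add: mult_Aut_tree_apply[OF g h] compose_def
          letter_section_def[of X "g \<otimes>\<^bsub>Aut_tree X\<^esub> h"])
  next
    case False
    then show ?thesis by (simp add: letter_section_def[of X "g \<otimes>\<^bsub>Aut_tree X\<^esub> h"] compose_def)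
  qed
  then show ?thesis
    by (subst mult_Aut_tree[OF letter_section_tree_aut[OF g y] letter_section_tree_aut[OF h x]])
      (rule ext)
qed

text \<open>Below a letter at which both automorphisms reproduce themselves, their agreement follows by
  recursion on the word; only the root permutations and the sections at the other letters have to be
  compared.\<close>

lemma tree_aut_eqI:
  assumes g: "g \<in> tree_aut X" and h: "h \<in> tree_aut X"
    and root: "root_perm X g = root_perm X h"
    and sect: "\<And>x. x \<in> X \<Longrightarrow> letter_section X g x = letter_section X h x \<or>
      (letter_section X g x = g \<and> letter_section X h x = h)"
  shows "g = h"
proof (rule extensionalityI[of _ "lists X"])
  show "g \<in> extensional (lists X)" "h \<in> extensional (lists X)"
    using g h by (auto dest!: tree_aut_Bij simp: Bij_def)
  show "g w = h w" if "w \<in> lists X" for w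
    using that
  proof (induction w)
    case Nil
    then show ?case by (simp add: tree_aut_Nil[OF g] tree_aut_Nil[OF h])
  next
    case (Cons x w)
    then have "letter_section X g x w = letter_section X h x w"
      using sect[of x] by auto
    then show ?case
      using Cons by (simp add: tree_aut_Cons[OF g] tree_aut_Cons[OF h] root)
  qed
qed

lemma group_hom_root_perm: "group_hom (Aut_tree X) (BijGroup X) (root_perm X)"
proof (intro group_hom.intro group_hom_axioms.intro homI)
  fix g h assume "g \<in> carrier (Aut_tree X)" "h \<in> carrier (Aut_tree X)"
  then have gh: "g \<in> tree_aut X" "h \<in> tree_aut X" by (simp_all add: carrier_Aut_tree)
  have "root_perm X (g \<otimes>\<^bsub>Aut_tree X\<^esub> h) = compose X (root_perm X g) (root_perm X h)"
  proof
    fix x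
    show "root_perm X (g \<otimes>\<^bsub>Aut_tree X\<^esub> h) x = compose X (root_perm X g) (root_perm X h) x"
      using root_perm_mult[OF gh, of x]
      by (cases "x \<in> X") (simp_all add: compose_def root_perm_def[of X "g \<otimes>\<^bsub>Aut_tree X\<^esub> h"])
  qed
  then show "root_perm X (g \<otimes>\<^bsub>Aut_tree X\<^esub> h) = root_perm X g \<otimes>\<^bsub>BijGroup X\<^esub> root_perm X h"
    using gh by (simp add: BijGroup_def root_perm_Bij)
next
  fix g assume "g \<in> carrier (Aut_tree X)"
  then show "root_perm X g \<in> carrier (BijGroup X)"
    by (simp add: carrier_Aut_tree root_perm_Bij BijGroup_def)
qed (simp_all add: group_Aut_tree group_BijGroup)

lemma inv_tree_aut: "g \<in> tree_aut X \<Longrightarrow> inv\<^bsub>Aut_tree X\<^esub> g \<in> tree_aut X"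
  using Aut.inv_closed[of g X] by (simp add: carrier_Aut_tree)

lemma root_perm_inv:
  assumes g: "g \<in> tree_aut X" and x: "x \<in> X"
  shows "root_perm X (inv\<^bsub>Aut_tree X\<^esub> g) (root_perm X g x) = x"
  using root_perm_mult[OF inv_tree_aut[OF g] g x] g x
  by (simp add: carrier_Aut_tree root_perm_one)

lemma letter_section_inv:
  assumes g: "g \<in> tree_aut X" and x: "x \<in> X"
  shows "letter_section X (inv\<^bsub>Aut_tree X\<^esub> g) (root_perm X g x)
    = inv\<^bsub>Aut_tree X\<^esub> (letter_section X g x)"
proof -
  have "letter_section X (inv\<^bsub>Aut_tree X\<^esub> g) (root_perm X g x) \<otimes>\<^bsub>Aut_tree X\<^esub> letter_section X g x
      = \<one>\<^bsub>Aut_tree X\<^esub>"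
    using letter_section_mult[OF inv_tree_aut[OF g] g x] g x
    by (simp add: carrier_Aut_tree letter_section_one)
  then show ?thesis
    using letter_section_tree_aut[OF g x]
      letter_section_tree_aut[OF inv_tree_aut[OF g] root_perm_mem[OF g x]]
    by (intro Aut.inv_equality[symmetric]) (simp_all add: carrier_Aut_tree)
qed

section \<open>Hanoi automorphisms\<close>

lemma hanoi_tree_aut: "a \<in> hanoi_automorphisms k \<Longrightarrow> a \<in> tree_aut {..<k}"
  by (simp add: hanoi_automorphisms_def)

lemma hanoi_partition_inactive:
  assumes "a \<in> hanoi_automorphisms k"
  shows "hanoi_partition k a ({..<k} - inactive_pegs k a) (inactive_pegs k a)"
proof (cases "a = \<one>\<^bsub>Aut_tree {..<k}\<^esub>")
  case True
  then show ?thesis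
    by (simp add: hanoi_partition_def inactive_pegs_def letter_section_one root_perm_one)
next
  case False
  obtain P Q where pq: "hanoi_partition k a P Q"
    using assms by (auto simp: hanoi_automorphisms_def)
  then have "P = {..<k} - Q" by (auto simp: hanoi_partition_def)
  with pq hanoi_partition_inactive_pegs[OF False pq] show ?thesis by simp
qed

lemma inactive_pegs_subset: "a \<in> hanoi_automorphisms k \<Longrightarrow> inactive_pegs k a \<subseteq> {..<k}"
  by (drule hanoi_partition_inactive) (auto simp: hanoi_partition_def)

lemma inactive_root_perm:
  "a \<in> hanoi_automorphisms k \<Longrightarrow> x \<in> inactive_pegs k a \<Longrightarrow> root_perm {..<k} a x = x"
  by (drule hanoi_partition_inactive) (auto simp: hanoi_partition_def)

lemma inactive_section:
  "a \<in> hanoi_automorphisms k \<Longrightarrow> x \<in> inactive_pegs k a \<Longrightarrow> letter_section {..<k} a x = a"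
  by (drule hanoi_partition_inactive) (auto simp: hanoi_partition_def)

lemma active_section:
  "a \<in> hanoi_automorphisms k \<Longrightarrow> x < k \<Longrightarrow> x \<notin> inactive_pegs k a \<Longrightarrow>
    letter_section {..<k} a x = \<one>\<^bsub>Aut_tree {..<k}\<^esub>"
  by (drule hanoi_partition_inactive) (auto simp: hanoi_partition_def)

text \<open>A Hanoi automorphism is determined by its root permutation and its inactive pegs.\<close>

lemma finite_hanoi_automorphisms: "finite (hanoi_automorphisms k)"
proof (rule finite_imageD)
  let ?f = "\<lambda>a. (root_perm {..<k} a, inactive_pegs k a)"
  have "?f a \<in> ({..<k} \<rightarrow>\<^sub>E {..<k}) \<times> Pow {..<k}" if a: "a \<in> hanoi_automorphisms k" for a
    using inactive_pegs_subset[OF a] root_perm_PiE[OF hanoi_tree_aut[OF a]] by simp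
  then have "?f ` hanoi_automorphisms k \<subseteq> ({..<k} \<rightarrow>\<^sub>E {..<k}) \<times> Pow {..<k}"
    by blast
  then show "finite (?f ` hanoi_automorphisms k)"
    by (rule finite_subset) (auto intro: finite_PiE)
  show "inj_on ?f (hanoi_automorphisms k)"
  proof (rule inj_onI)
    fix a b
    assume a: "a \<in> hanoi_automorphisms k" and b: "b \<in> hanoi_automorphisms k" and "?f a = ?f b"
    then have eq: "root_perm {..<k} a = root_perm {..<k} b" "inactive_pegs k a = inactive_pegs k b"
      by auto
    show "a = b"
    proof (rule tree_aut_eqI[OF hanoi_tree_aut[OF a] hanoi_tree_aut[OF b] eq(1)])
      fix x assume "x \<in> {..<k}"
      then show "letter_section {..<k} a x = letter_section {..<k} b x \<or>
          letter_section {..<k} a x = a \<and> letter_section {..<k} b x = b"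
        using a b eq(2)
        by (cases "x \<in> inactive_pegs k a") (simp_all add: inactive_section active_section)
    qed
  qed
qed

lemma hanoi_inv:
  assumes a: "a \<in> hanoi_automorphisms k"
  shows "inv\<^bsub>Aut_tree {..<k}\<^esub> a \<in> hanoi_automorphisms k"
    and "inactive_pegs k (inv\<^bsub>Aut_tree {..<k}\<^esub> a) = inactive_pegs k a"
proof -
  let ?A = "Aut_tree {..<k}" and ?b = "inv\<^bsub>Aut_tree {..<k}\<^esub> a" and ?Q = "inactive_pegs k a"
  note t = hanoi_tree_aut[OF a]
  have "letter_section {..<k} ?b i = \<one>\<^bsub>?A\<^esub>" if i: "i \<in> {..<k} - ?Q" for i
  proof -
    obtain x where x: "x \<in> {..<k}" "i = root_perm {..<k} a x"
      using root_perm_Bij[OF t] i by (auto simp: Bij_def bij_betw_def)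
    then have "x \<notin> ?Q" using i inactive_root_perm[OF a] by auto
    then show ?thesis
      using letter_section_inv[OF t x(1)] active_section[OF a, of x] x by simp
  qed
  moreover have "letter_section {..<k} ?b j = ?b" "root_perm {..<k} ?b j = j" if "j \<in> ?Q" for j
    using letter_section_inv[OF t, of j] root_perm_inv[OF t, of j] that inactive_pegs_subset[OF a]
    by (auto simp: inactive_section[OF a] inactive_root_perm[OF a])
  ultimately have part: "hanoi_partition k ?b ({..<k} - ?Q) ?Q"
    using inactive_pegs_subset[OF a] by (auto simp: hanoi_partition_def)
  then show "?b \<in> hanoi_automorphisms k"
    using inv_tree_aut[OF t] by (auto simp: hanoi_automorphisms_def)
  show "inactive_pegs k ?b = ?Q"
  proof (cases "a = \<one>\<^bsub>?A\<^esub>")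
    case False
    then have "?b \<noteq> \<one>\<^bsub>?A\<^esub>"
      using t Aut.inv_inv[of a "{..<k}"] by (auto simp: carrier_Aut_tree)
    then show ?thesis using part by (rule hanoi_partition_inactive_pegs)
  qed simp
qed

section \<open>Words in Hanoi automorphisms\<close>

text \<open>An inverse of a Hanoi automorphism is again one with the same inactive pegs, so generators
  and their inverses can be treated alike: \<open>a\<close> below stands for either \<open>s\<close> or its inverse.\<close>

lemma hanoi_generate_induct [consumes 2, case_names one letter mult]:
  assumes T: "T \<subseteq> hanoi_automorphisms k" and g: "g \<in> generate (Aut_tree {..<k}) T"
    and one: "P \<one>\<^bsub>Aut_tree {..<k}\<^esub>"
    and letter: "\<And>s a. \<lbrakk>s \<in> T; a \<in> hanoi_automorphisms k; a \<in> generate (Aut_tree {..<k}) {s};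
      inactive_pegs k a = inactive_pegs k s\<rbrakk> \<Longrightarrow> P a"
    and mult: "\<And>g h. \<lbrakk>g \<in> generate (Aut_tree {..<k}) T; P g;
      h \<in> generate (Aut_tree {..<k}) T; P h\<rbrakk> \<Longrightarrow> P (g \<otimes>\<^bsub>Aut_tree {..<k}\<^esub> h)"
  shows "P g"
  using g
proof (induction rule: generate.induct)
  case one
  show ?case by (rule assms(3))
next
  case (incl s)
  then show ?case using letter[of s s] T by (auto intro: generate.incl)
next
  case (inv s)
  then show ?case using letter[of s] hanoi_inv[of s k] T by (auto intro: generate.inv)
next
  case (eng g h)
  then show ?case using mult by blast
qed

lemma hanoi_generate_tree_aut:
  assumes "T \<subseteq> hanoi_automorphisms k" "g \<in> generate (Aut_tree {..<k}) T"
  shows "g \<in> tree_aut {..<k}"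
  using Aut.generate_in_carrier[of T "{..<k}" g] assms hanoi_tree_aut
  by (auto simp: carrier_Aut_tree)

lemma generate_singleton_mono: "s \<in> T \<Longrightarrow> a \<in> generate (Aut_tree X) {s} \<Longrightarrow> a \<in> generate (Aut_tree X) T"
  using Aut.mono_generate[of "{s}" T X] by auto

abbreviation word_product :: "'a set \<Rightarrow> ('a list \<Rightarrow> 'a list) list \<Rightarrow> 'a list \<Rightarrow> 'a list" where
  "word_product X ws \<equiv> foldr (\<lambda>a b. a \<otimes>\<^bsub>Aut_tree X\<^esub> b) ws \<one>\<^bsub>Aut_tree X\<^esub>"

lemma word_product_tree_aut: "set ws \<subseteq> tree_aut X \<Longrightarrow> word_product X ws \<in> tree_aut X"
  using Aut.one_closed[of X] Aut.m_closed[of _ X] by (induction ws) (auto simp: carrier_Aut_tree)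

lemma word_product_mem_generate:
  "(\<And>a. a \<in> set ws \<Longrightarrow> a \<in> generate (Aut_tree X) T) \<Longrightarrow> word_product X ws \<in> generate (Aut_tree X) T"
  by (induction ws) (simp_all add: generate.one generate.eng)

lemma word_product_append:
  "set us \<subseteq> tree_aut X \<Longrightarrow> set vs \<subseteq> tree_aut X \<Longrightarrow>
    word_product X (us @ vs) = word_product X us \<otimes>\<^bsub>Aut_tree X\<^esub> word_product X vs"
proof (induction us)
  case Nil
  then show ?case using word_product_tree_aut[of vs X] by (simp add: carrier_Aut_tree)
next
  case (Cons a us)
  then show ?case
    using word_product_tree_aut[of us X] word_product_tree_aut[of vs X]
    by (simp add: carrier_Aut_tree Aut.m_assoc)
qed

lemma hanoi_generate_word:
  assumes T: "T \<subseteq> hanoi_automorphisms k" and g: "g \<in> generate (Aut_tree {..<k}) T"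
  shows "\<exists>ws. g = word_product {..<k} ws \<and> (\<forall>a\<in>set ws. a \<in> hanoi_automorphisms k \<and>
    (\<exists>s\<in>T. a \<in> generate (Aut_tree {..<k}) {s} \<and> inactive_pegs k a = inactive_pegs k s))"
    (is "\<exists>ws. _ \<and> (\<forall>a\<in>set ws. ?L a)")
  using T g
proof (induction rule: hanoi_generate_induct)
  case one
  show ?case by (intro exI[of _ "[]"]) simp
next
  case (letter s a)
  then show ?case
    using hanoi_tree_aut[of a k] by (intro exI[of _ "[a]"]) (auto simp: carrier_Aut_tree)
next
  case (mult g h)
  then obtain us vs where us: "g = word_product {..<k} us" "\<forall>a\<in>set us. ?L a"
    and vs: "h = word_product {..<k} vs" "\<forall>a\<in>set vs. ?L a"
    by blast
  have "set us \<subseteq> tree_aut {..<k}" "set vs \<subseteq> tree_aut {..<k}"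
    using us vs hanoi_tree_aut by blast+
  then have "g \<otimes>\<^bsub>Aut_tree {..<k}\<^esub> h = word_product {..<k} (us @ vs)"
    using us vs by (simp only: word_product_append)
  then show ?case using us vs by (intro exI[of _ "us @ vs"]) auto
qed

text \<open>Taking the section of a product letter by letter turns every letter that meets one of its
  active pegs into the identity. The word keeps its length only if no letter does so; then no
  letter moves \<open>x\<close>, and \<open>x\<close> is inactive for all of them.\<close>

lemma section_word_product:
  assumes "set ws \<subseteq> hanoi_automorphisms k" and x: "x < k"
  shows "\<exists>ws'. set ws' \<subseteq> set ws \<and>
    letter_section {..<k} (word_product {..<k} ws) x = word_product {..<k} ws' \<and>
    (length ws' < length ws \<or>
      ws' = ws \<and> (\<forall>a\<in>set ws. x \<in> inactive_pegs k a) \<and> root_perm {..<k} (word_product {..<k} ws) x = x)"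
  using assms(1)
proof (induction ws)
  case Nil
  then show ?case using x by (simp add: letter_section_one root_perm_one)
next
  case (Cons a ws)
  let ?g = "word_product {..<k} ws"
  let ?y = "root_perm {..<k} ?g x"
  have a: "a \<in> hanoi_automorphisms k" and ws: "set ws \<subseteq> hanoi_automorphisms k"
    using Cons.prems by auto
  have g: "?g \<in> tree_aut {..<k}"
    using ws hanoi_tree_aut by (intro word_product_tree_aut) blast
  obtain ws' where ws': "set ws' \<subseteq> set ws" "letter_section {..<k} ?g x = word_product {..<k} ws'"
    "length ws' < length ws \<or>
      ws' = ws \<and> (\<forall>a\<in>set ws. x \<in> inactive_pegs k a) \<and> root_perm {..<k} ?g x = x"
    using Cons.IH ws by blast
  have sect: "letter_section {..<k} (word_product {..<k} (a # ws)) x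
      = letter_section {..<k} a ?y \<otimes>\<^bsub>Aut_tree {..<k}\<^esub> word_product {..<k} ws'"
    using letter_section_mult[OF hanoi_tree_aut[OF a] g, of x] x ws'(2) by simp
  show ?case
  proof (cases "?y \<in> inactive_pegs k a")
    case True
    have "letter_section {..<k} (word_product {..<k} (a # ws)) x = word_product {..<k} (a # ws')"
      using sect inactive_section[OF a True] by simp
    moreover have "root_perm {..<k} (word_product {..<k} (a # ws)) x = ?y"
      using root_perm_mult[OF hanoi_tree_aut[OF a] g, of x] x inactive_root_perm[OF a True] by simp
    ultimately show ?thesis
      using ws'(1,3) True by (intro exI[of _ "a # ws'"]) auto
  next
    case False
    have "set ws' \<subseteq> tree_aut {..<k}" using ws'(1) ws hanoi_tree_aut by blast
    then have g': "word_product {..<k} ws' \<in> tree_aut {..<k}" by (rule word_product_tree_aut)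
    have "?y < k" using root_perm_mem[OF g, of x] x by simp
    then have "letter_section {..<k} (word_product {..<k} (a # ws)) x = word_product {..<k} ws'"
      using sect active_section[OF a _ False] g' by (simp add: carrier_Aut_tree)
    then show ?thesis
      using ws'(1,3) by (intro exI[of _ ws']) auto
  qed
qed

section \<open>Orbits and sections in a group generated by Hanoi automorphisms\<close>

lemma peg_orbit_eq:
  assumes "T \<subseteq> hanoi_automorphisms k"
  shows "peg_orbit k T j = (\<lambda>g. root_perm {..<k} g j) ` generate (Aut_tree {..<k}) T"
proof -
  interpret group_hom "Aut_tree {..<k}" "BijGroup {..<k}" "root_perm {..<k}"
    by (rule group_hom_root_perm)
  have "generate (BijGroup {..<k}) (root_perm {..<k} ` T)
      = root_perm {..<k} ` generate (Aut_tree {..<k}) T"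
    using assms hanoi_tree_aut by (intro generate_img) (auto simp: carrier_Aut_tree)
  then show ?thesis by (auto simp: peg_orbit_def orbit_def)
qed

lemma peg_orbit_subset:
  assumes "T \<subseteq> hanoi_automorphisms k" "j < k"
  shows "peg_orbit k T j \<subseteq> {..<k}"
  using assms root_perm_mem[OF hanoi_generate_tree_aut[OF assms(1)], of _ j]
  by (auto simp: peg_orbit_eq)

lemma peg_orbit_refl:
  assumes "T \<subseteq> hanoi_automorphisms k" "j < k"
  shows "j \<in> peg_orbit k T j"
  using assms root_perm_one[of j "{..<k}"] generate.one[of "Aut_tree {..<k}" T]
  by (force simp: peg_orbit_eq)

lemma peg_orbit_closed:
  assumes T: "T \<subseteq> hanoi_automorphisms k" and j: "j < k"
    and i: "i \<in> peg_orbit k T j" and g: "g \<in> generate (Aut_tree {..<k}) T"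
  shows "root_perm {..<k} g i \<in> peg_orbit k T j"
proof -
  obtain h where h: "h \<in> generate (Aut_tree {..<k}) T" "i = root_perm {..<k} h j"
    using i by (auto simp: peg_orbit_eq[OF T])
  have "root_perm {..<k} g i = root_perm {..<k} (g \<otimes>\<^bsub>Aut_tree {..<k}\<^esub> h) j"
    using root_perm_mult[OF hanoi_generate_tree_aut[OF T g] hanoi_generate_tree_aut[OF T h(1)]] h j
    by simp
  then show ?thesis
    using generate.eng[OF g h(1)] by (auto simp: peg_orbit_eq[OF T])
qed

text \<open>While a word is applied, the peg under consideration stays in its orbit. A generator all of
  whose inactive pegs avoid the orbit therefore contributes nothing to a section taken there.\<close>

lemma section_mem_generate_orbit:
  assumes T: "T \<subseteq> hanoi_automorphisms k" and j: "j < k" and i: "i \<in> peg_orbit k T j"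
    and g: "g \<in> generate (Aut_tree {..<k}) T"
  shows "letter_section {..<k} g i
    \<in> generate (Aut_tree {..<k}) {s \<in> T. peg_orbit k T j \<inter> inactive_pegs k s \<noteq> {}}"
    (is "_ \<in> generate _ ?U")
  using T g i
proof (induction arbitrary: i rule: hanoi_generate_induct)
  case one
  then have "i \<in> {..<k}" using peg_orbit_subset[OF T j] by blast
  then show ?case by (simp only: letter_section_one generate.one)
next
  case (letter s a)
  show ?case
  proof (cases "i \<in> inactive_pegs k a")
    case True
    then have "s \<in> ?U" using letter by auto
    then show ?thesis
      using True letter inactive_section[of a k i] generate_singleton_mono[of s ?U a] by simp
  next
    case False
    have "i < k" using peg_orbit_subset[OF T j] letter by auto
    then show ?thesis
      using False letter active_section[of a k i] by (auto intro: generate.one)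
  qed
next
  case (mult g h)
  have "i \<in> {..<k}" using peg_orbit_subset[OF T j] mult by blast
  moreover have "root_perm {..<k} h i \<in> peg_orbit k T j"
    using peg_orbit_closed[OF T j] mult by blast
  ultimately show ?case
    using mult letter_section_mult[of g "{..<k}" h i] hanoi_generate_tree_aut[OF T]
    by (auto intro: generate.eng)
qed

lemma section_mem_generate:
  assumes T: "T \<subseteq> hanoi_automorphisms k" and j: "j < k"
    and g: "g \<in> generate (Aut_tree {..<k}) T"
  shows "letter_section {..<k} g j \<in> generate (Aut_tree {..<k}) T"
  using section_mem_generate_orbit[OF T j peg_orbit_refl[OF T j] g]
    Aut.mono_generate[of "{s \<in> T. peg_orbit k T j \<inter> inactive_pegs k s \<noteq> {}}" T "{..<k}"]
  by blast

lemma word_section_mem_generate: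
  assumes T: "T \<subseteq> hanoi_automorphisms k"
  shows "v \<in> lists {..<k} \<Longrightarrow> g \<in> generate (Aut_tree {..<k}) T \<Longrightarrow>
    word_section {..<k} g v \<in> generate (Aut_tree {..<k}) T"
  by (induction v arbitrary: g) (auto intro: section_mem_generate[OF T])

lemma common_inactive_peg:
  assumes T: "T \<subseteq> hanoi_automorphisms k" and e: "e \<in> essential_set k T"
    and g: "g \<in> generate (Aut_tree {..<k}) T"
  shows "root_perm {..<k} g e = e" "letter_section {..<k} g e = g"
proof -
  have "root_perm {..<k} g e = e \<and> letter_section {..<k} g e = g"
    using T g
  proof (induction rule: hanoi_generate_induct)
    case one
    then show ?case using e by (simp add: essential_set_def letter_section_one root_perm_one)
  next
    case (letter s a)
    then have "e \<in> inactive_pegs k a" using e by (auto simp: essential_set_def)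
    then show ?case using letter inactive_section inactive_root_perm by blast
  next
    case (mult g h)
    have "e \<in> {..<k}" using e by (simp add: essential_set_def)
    then show ?case
      using mult root_perm_mult[of g "{..<k}" h e] letter_section_mult[of g "{..<k}" h e]
        hanoi_generate_tree_aut[OF T] by auto
  qed
  then show "root_perm {..<k} g e = e" "letter_section {..<k} g e = g" by auto
qed

lemma peg_orbit_fixed:
  assumes T: "T \<subseteq> hanoi_automorphisms k" and j: "j \<in> fixed_pegs k T"
  shows "peg_orbit k T j = {j}"
proof -
  have jk: "j \<in> {..<k}" using j by (simp add: fixed_pegs_def)
  have "root_perm {..<k} g j = j" if "g \<in> generate (Aut_tree {..<k}) T" for g
    using that
  proof (induction rule: generate.induct)
    case one
    then show ?case using jk by (simp add: root_perm_one)
  next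
    case (incl s)
    then show ?case using j by (simp add: fixed_pegs_def)
  next
    case (inv s)
    then have "root_perm {..<k} s j = j" using j by (simp add: fixed_pegs_def)
    then show ?case using root_perm_inv[of s "{..<k}" j] jk inv T hanoi_tree_aut by auto
  next
    case (eng g h)
    then show ?case
      using jk root_perm_mult[of g "{..<k}" h j] hanoi_generate_tree_aut[OF T] by auto
  qed
  then show ?thesis
    using peg_orbit_refl[OF T] jk by (auto simp: peg_orbit_eq[OF T])
qed

section \<open>Finiteness of subgroups whose generators share an inactive peg\<close>

text \<open>An element of the group reproduces itself below each essential peg, hence is determined by
  its root permutation and its sections at the other pegs. Such a peg either is moved, and the
  hypothesis discards a generator from the sections there, or is a fixed peg at which some
  generator is active. Either way these sections lie in the group of a proper subset of \<open>T\<close>, which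
  is finite by induction.\<close>

lemma finite_generate_of_orbit_condition:
  assumes T: "T \<subseteq> hanoi_automorphisms k" and e: "essential_set k T \<noteq> {}"
    and cond: "\<And>T' j. \<lbrakk>T' \<subseteq> T; essential_set k T' \<noteq> {}; j < k; j \<notin> fixed_pegs k T'\<rbrakk>
      \<Longrightarrow> \<exists>s\<in>T'. peg_orbit k T' j \<inter> inactive_pegs k s = {}"
  shows "finite (generate (Aut_tree {..<k}) T)"
  using finite_subset[OF T finite_hanoi_automorphisms] assms
proof (induction rule: finite_psubset_induct)
  case (psubset T)
  let ?G = "generate (Aut_tree {..<k}) T" and ?E = "essential_set k T"
  let ?U = "\<lambda>j. {s \<in> T. peg_orbit k T j \<inter> inactive_pegs k s \<noteq> {}}"
  note T = psubset.prems(1)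
  \<comment> \<open>The orbit of a fixed peg is a singleton, so \<open>?U\<close> covers moved and fixed pegs alike.\<close>
  have fin: "finite (generate (Aut_tree {..<k}) (?U j))" if j: "j \<in> {..<k} - ?E" for j
  proof (rule psubset.IH)
    show "?U j \<subset> T"
    proof (cases "j \<in> fixed_pegs k T")
      case True
      then show ?thesis
        using j peg_orbit_fixed[OF T True] by (auto simp: essential_set_def)
    next
      case False
      then show ?thesis
        using psubset.prems(3)[of T j] psubset.prems(2) j by auto
    qed
    show "?U j \<subseteq> hanoi_automorphisms k" using T by auto
    show "essential_set k (?U j) \<noteq> {}"
      using psubset.prems(2) by (auto simp: essential_set_def)
    show "\<exists>s\<in>T'. peg_orbit k T' i \<inter> inactive_pegs k s = {}"
      if "T' \<subseteq> ?U j" "essential_set k T' \<noteq> {}" "i < k" "i \<notin> fixed_pegs k T'" for T' i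
      using that by (intro psubset.prems(3)) auto
  qed
  let ?f = "\<lambda>g. (root_perm {..<k} g, \<lambda>j\<in>{..<k} - ?E. letter_section {..<k} g j)"
  have "?f g \<in> ({..<k} \<rightarrow>\<^sub>E {..<k}) \<times> (\<Pi>\<^sub>E j\<in>{..<k} - ?E. generate (Aut_tree {..<k}) (?U j))"
    if g: "g \<in> ?G" for g
  proof -
    show ?thesis
      using root_perm_PiE[OF hanoi_generate_tree_aut[OF T g]] section_mem_generate_orbit[OF T _ peg_orbit_refl[OF T] g] by auto
  qed
  then have "?f ` ?G \<subseteq> ({..<k} \<rightarrow>\<^sub>E {..<k}) \<times> (\<Pi>\<^sub>E j\<in>{..<k} - ?E. generate (Aut_tree {..<k}) (?U j))"
    by blast
  moreover have "finite (({..<k} \<rightarrow>\<^sub>E {..<k}) \<times> (\<Pi>\<^sub>E j\<in>{..<k} - ?E. generate (Aut_tree {..<k}) (?U j)))"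
    using fin by (intro finite_cartesian_product finite_PiE) auto
  ultimately have "finite (?f ` ?G)" by (rule finite_subset)
  moreover have "inj_on ?f ?G"
  proof (rule inj_onI)
    fix g h assume g: "g \<in> ?G" and h: "h \<in> ?G" and "?f g = ?f h"
    then have root: "root_perm {..<k} g = root_perm {..<k} h"
      and sect: "(\<lambda>j\<in>{..<k} - ?E. letter_section {..<k} g j)
        = (\<lambda>j\<in>{..<k} - ?E. letter_section {..<k} h j)"
      by blast+
    show "g = h"
    proof (rule tree_aut_eqI[OF hanoi_generate_tree_aut[OF T g] hanoi_generate_tree_aut[OF T h] root])
      fix x assume x: "x \<in> {..<k}"
      show "letter_section {..<k} g x = letter_section {..<k} h x \<or>
          letter_section {..<k} g x = g \<and> letter_section {..<k} h x = h"
        using common_inactive_peg(2)[OF T] g h x fun_cong[OF sect, of x] by (cases "x \<in> ?E") auto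
    qed
  qed
  ultimately show ?case by (rule finite_imageD)
qed

text \<open>A peg is moved only by a generator for which it is active, and the section there is trivial.
  Leaving out the steps that do not move the peg gives the required path.\<close>

lemma path_with_trivial_section:
  assumes T: "T \<subseteq> hanoi_automorphisms k" and g: "g \<in> generate (Aut_tree {..<k}) T" and i: "i < k"
  shows "\<exists>h\<in>generate (Aut_tree {..<k}) T. root_perm {..<k} h i = root_perm {..<k} g i \<and>
    letter_section {..<k} h i = \<one>\<^bsub>Aut_tree {..<k}\<^esub>"
  using T g i
proof (induction arbitrary: i rule: hanoi_generate_induct)
  case one
  then show ?case
    using letter_section_one[of i "{..<k}"] by (auto intro!: bexI[OF _ generate.one])
next
  case (letter s a)
  show ?case
  proof (cases "i \<in> inactive_pegs k a")
    case True
    then show ?thesis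
      using letter inactive_root_perm[of a k i] root_perm_one[of i "{..<k}"]
        letter_section_one[of i "{..<k}"]
      by (auto intro!: bexI[OF _ generate.one])
  next
    case False
    then show ?thesis
      using letter active_section[of a k i] generate_singleton_mono[of s T a] by auto
  qed
next
  case (mult g h)
  let ?A = "Aut_tree {..<k}"
  note t = hanoi_generate_tree_aut[OF T]
  obtain h' where h': "h' \<in> generate ?A T" "root_perm {..<k} h' i = root_perm {..<k} h i"
    "letter_section {..<k} h' i = \<one>\<^bsub>?A\<^esub>"
    using mult by blast
  have i: "i \<in> {..<k}" and y: "root_perm {..<k} h i < k"
    using root_perm_mem[OF t, of h i] mult by auto
  obtain g' where g': "g' \<in> generate ?A T"
    "root_perm {..<k} g' (root_perm {..<k} h i) = root_perm {..<k} g (root_perm {..<k} h i)"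
    "letter_section {..<k} g' (root_perm {..<k} h i) = \<one>\<^bsub>?A\<^esub>"
    using mult y by blast
  have "root_perm {..<k} (g' \<otimes>\<^bsub>?A\<^esub> h') i = root_perm {..<k} (g \<otimes>\<^bsub>?A\<^esub> h) i"
    using root_perm_mult[OF t t i] g' h' mult by simp
  moreover have "letter_section {..<k} (g' \<otimes>\<^bsub>?A\<^esub> h') i = \<one>\<^bsub>?A\<^esub>"
    using letter_section_mult[OF t t i, of g' h'] g' h' by simp
  ultimately show ?case using generate.eng[OF g'(1) h'(1)] by blast
qed

text \<open>Every generator \<open>s\<close> has an inactive peg \<open>q\<close> in the orbit of \<open>j\<close>. Walking from \<open>j\<close> to \<open>q\<close>,
  applying \<open>s\<close>, and walking back along paths with trivial section fixes \<open>j\<close> and has section \<open>s\<close>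
  there.\<close>

lemma stabilizer_section_onto:
  assumes T: "T \<subseteq> hanoi_automorphisms k" and j: "j < k"
    and meet: "\<And>s. s \<in> T \<Longrightarrow> peg_orbit k T j \<inter> inactive_pegs k s \<noteq> {}"
    and g: "g \<in> generate (Aut_tree {..<k}) T"
  shows "\<exists>h\<in>generate (Aut_tree {..<k}) T. root_perm {..<k} h j = j \<and> letter_section {..<k} h j = g"
  using T g
proof (induction rule: hanoi_generate_induct)
  case one
  then show ?case
    using j root_perm_one[of j "{..<k}"] letter_section_one[of j "{..<k}"]
    by (auto intro!: bexI[OF _ generate.one])
next
  case (letter s a)
  let ?A = "Aut_tree {..<k}"
  note t = hanoi_generate_tree_aut[OF T]
  have jX: "j \<in> {..<k}" using j by simp
  obtain q where q: "q \<in> peg_orbit k T j" "q \<in> inactive_pegs k a"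
    using meet[of s] letter by auto
  then obtain p where p: "p \<in> generate ?A T" "q = root_perm {..<k} p j"
    by (auto simp: peg_orbit_eq[OF T])
  have qX: "q \<in> {..<k}" using q peg_orbit_subset[OF T j] by auto
  have p': "inv\<^bsub>?A\<^esub> p \<in> generate ?A T"
    using Aut.generate_m_inv_closed[of T "{..<k}" p] p T hanoi_tree_aut
    by (auto simp: carrier_Aut_tree)
  obtain u where u: "u \<in> generate ?A T" "root_perm {..<k} u j = q"
    "letter_section {..<k} u j = \<one>\<^bsub>?A\<^esub>"
    using path_with_trivial_section[OF T p(1) j] p(2) by auto
  obtain d where d: "d \<in> generate ?A T" "root_perm {..<k} d q = j"
    "letter_section {..<k} d q = \<one>\<^bsub>?A\<^esub>"
    using path_with_trivial_section[OF T p', of q] qX p(2) root_perm_inv[OF t[OF p(1)] jX] by auto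
  have a: "a \<in> generate ?A T" using letter generate_singleton_mono by blast
  have au: "a \<otimes>\<^bsub>?A\<^esub> u \<in> generate ?A T" using a u(1) by (rule generate.eng)
  have "root_perm {..<k} (a \<otimes>\<^bsub>?A\<^esub> u) j = q" "letter_section {..<k} (a \<otimes>\<^bsub>?A\<^esub> u) j = a"
    using root_perm_mult[OF t t jX, of a u] letter_section_mult[OF t t jX, of a u] a u
      letter q t[OF a] inactive_root_perm[of a k q] inactive_section[of a k q]
    by (simp_all add: carrier_Aut_tree)
  then have "root_perm {..<k} (d \<otimes>\<^bsub>?A\<^esub> (a \<otimes>\<^bsub>?A\<^esub> u)) j = j"
    "letter_section {..<k} (d \<otimes>\<^bsub>?A\<^esub> (a \<otimes>\<^bsub>?A\<^esub> u)) j = a"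
    using root_perm_mult[OF t t jX, of d "a \<otimes>\<^bsub>?A\<^esub> u"] d au t[OF a]
      letter_section_mult[OF t t jX, of d "a \<otimes>\<^bsub>?A\<^esub> u"]
    by (simp_all add: carrier_Aut_tree)
  then show ?case using generate.eng[OF d(1) au] by blast
next
  case (mult g h)
  let ?A = "Aut_tree {..<k}"
  note t = hanoi_generate_tree_aut[OF T]
  obtain g' h' where g': "g' \<in> generate ?A T" "root_perm {..<k} g' j = j" "letter_section {..<k} g' j = g"
    and h': "h' \<in> generate ?A T" "root_perm {..<k} h' j = j" "letter_section {..<k} h' j = h"
    using mult by blast
  have "root_perm {..<k} (g' \<otimes>\<^bsub>?A\<^esub> h') j = j" "letter_section {..<k} (g' \<otimes>\<^bsub>?A\<^esub> h') j = g \<otimes>\<^bsub>?A\<^esub> h"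
    using root_perm_mult[OF t t, of g' h' j] letter_section_mult[OF t t, of g' h' j] g' h' j by simp_all
  then show ?case using generate.eng[OF g'(1) h'(1)] by blast
qed

text \<open>A finite set is not the image of a proper subset of itself, here the stabilizer of \<open>j\<close>.\<close>

lemma orbit_avoids_inactive_pegs_of_finite_generate:
  assumes T: "T \<subseteq> hanoi_automorphisms k" and fin: "finite (generate (Aut_tree {..<k}) T)"
    and j: "j < k" "j \<notin> fixed_pegs k T"
  shows "\<exists>s\<in>T. peg_orbit k T j \<inter> inactive_pegs k s = {}"
proof (rule ccontr)
  assume "\<not> ?thesis"
  then have meet: "peg_orbit k T j \<inter> inactive_pegs k s \<noteq> {}" if "s \<in> T" for s
    using that by blast
  let ?G = "generate (Aut_tree {..<k}) T"
  let ?Stab = "{h \<in> ?G. root_perm {..<k} h j = j}"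
  obtain s where "s \<in> T" "root_perm {..<k} s j \<noteq> j"
    using j by (auto simp: fixed_pegs_def)
  then have "?Stab \<subset> ?G" using generate.incl[of s T] by blast
  then have "card ?Stab < card ?G" using fin by (simp add: psubset_card_mono)
  moreover have "?G \<subseteq> (\<lambda>h. letter_section {..<k} h j) ` ?Stab"
    using stabilizer_section_onto[OF T j(1) meet] by blast
  then have "card ?G \<le> card ?Stab"
    using fin by (intro surj_card_le) auto
  ultimately show False by simp
qed

section \<open>The nucleus\<close>

lemma word_section_common_inactive_peg:
  assumes T: "T \<subseteq> hanoi_automorphisms k" and e: "e \<in> essential_set k T"
    and g: "g \<in> generate (Aut_tree {..<k}) T"
  shows "word_section {..<k} g (replicate n e) = g"
  by (induction n) (simp_all add: common_inactive_peg(2)[OF T e g])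

text \<open>Sections at long powers of an essential peg do not change an element, so the nucleus contains
  the whole group.\<close>

lemma finite_generate_of_contracting:
  assumes contr: "contracting {..<k} G" and T: "T \<subseteq> hanoi_automorphisms k"
    and TG: "generate (Aut_tree {..<k}) T \<subseteq> G" and e: "essential_set k T \<noteq> {}"
  shows "finite (generate (Aut_tree {..<k}) T)"
proof -
  obtain N where N: "finite N"
    and contr: "\<forall>g\<in>G. \<exists>n. \<forall>v\<in>lists {..<k}. n \<le> length v \<longrightarrow> word_section {..<k} g v \<in> N"
    using contr unfolding contracting_def by blast
  obtain e where e: "e \<in> essential_set k T" using e by blast
  then have ek: "e < k" by (simp add: essential_set_def)
  have "generate (Aut_tree {..<k}) T \<subseteq> N"
  proof
    fix g assume g: "g \<in> generate (Aut_tree {..<k}) T"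
    then obtain n where "\<forall>v\<in>lists {..<k}. n \<le> length v \<longrightarrow> word_section {..<k} g v \<in> N"
      using contr TG by blast
    moreover have "replicate n e \<in> lists {..<k}" "n \<le> length (replicate n e)"
      using ek by auto
    ultimately have "word_section {..<k} g (replicate n e) \<in> N" by blast
    then show "g \<in> N" by (simp add: word_section_common_inactive_peg[OF T e g])
  qed
  then show ?thesis using N by (rule finite_subset)
qed

text \<open>Sections shorten a word until it becomes empty or its letters share an inactive peg, so the
  union of the groups generated by all generators with a given inactive peg serves as nucleus.\<close>

lemma word_section_mem_nucleus:
  assumes S: "S \<subseteq> hanoi_automorphisms k" and k: "0 < k"
    and "\<And>a. a \<in> set ws \<Longrightarrow> a \<in> hanoi_automorphisms k \<and>
      (\<exists>s\<in>S. a \<in> generate (Aut_tree {..<k}) {s} \<and> inactive_pegs k a = inactive_pegs k s)"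
    and "v \<in> lists {..<k}" and "length ws \<le> length v"
  shows "word_section {..<k} (word_product {..<k} ws) v
    \<in> (\<Union>x<k. generate (Aut_tree {..<k}) {s \<in> S. x \<in> inactive_pegs k s})"
    (is "_ \<in> ?N")
  using assms(3-5)
proof (induction v arbitrary: ws)
  case Nil
  then show ?case using k by (auto intro: generate.one)
next
  case (Cons x v)
  let ?T = "{s \<in> S. x \<in> inactive_pegs k s}"
  have x: "x < k" and v: "v \<in> lists {..<k}" using Cons.prems by auto
  obtain ws' where ws': "set ws' \<subseteq> set ws"
    "letter_section {..<k} (word_product {..<k} ws) x = word_product {..<k} ws'"
    "length ws' < length ws \<or> ws' = ws \<and> (\<forall>a\<in>set ws. x \<in> inactive_pegs k a)"
    using section_word_product[of ws k x] Cons.prems(1) x by blast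
  show ?case
  proof (cases "length ws' < length ws")
    case True
    have "word_section {..<k} (word_product {..<k} ws') v \<in> ?N"
    proof (rule Cons.IH)
      show "a \<in> hanoi_automorphisms k \<and>
          (\<exists>s\<in>S. a \<in> generate (Aut_tree {..<k}) {s} \<and> inactive_pegs k a = inactive_pegs k s)"
        if "a \<in> set ws'" for a
        using that ws'(1) Cons.prems(1) by blast
      show "length ws' \<le> length v" using True Cons.prems(3) by simp
    qed (rule v)
    then show ?thesis using ws'(2) by simp
  next
    case False
    then have inact: "\<And>a. a \<in> set ws \<Longrightarrow> x \<in> inactive_pegs k a" and eq: "ws' = ws"
      using ws'(3) by auto
    have "a \<in> generate (Aut_tree {..<k}) ?T" if a: "a \<in> set ws" for a
    proof -
      obtain s where "s \<in> S" "a \<in> generate (Aut_tree {..<k}) {s}"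
        "inactive_pegs k a = inactive_pegs k s"
        using Cons.prems(1)[OF a] by blast
      then show ?thesis
        using inact[OF a] generate_singleton_mono[of s ?T a] by auto
    qed
    then have "word_product {..<k} ws \<in> generate (Aut_tree {..<k}) ?T"
      by (rule word_product_mem_generate)
    then have "word_section {..<k} (word_product {..<k} ws) v \<in> generate (Aut_tree {..<k}) ?T"
      using S v by (intro word_section_mem_generate) auto
    then show ?thesis using ws'(2) eq x by auto
  qed
qed

lemma contracting_of_finite_generate:
  assumes k: "0 < k" and S: "S \<subseteq> hanoi_automorphisms k"
    and fin: "\<And>T. \<lbrakk>T \<subseteq> S; essential_set k T \<noteq> {}\<rbrakk> \<Longrightarrow> finite (generate (Aut_tree {..<k}) T)"
  shows "contracting {..<k} (generate (Aut_tree {..<k}) S)"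
proof -
  let ?A = "Aut_tree {..<k}"
  let ?N = "\<Union>x<k. generate ?A {s \<in> S. x \<in> inactive_pegs k s}"
  have "subgroup (generate ?A S) ?A"
    using S hanoi_tree_aut by (intro Aut.generate_is_subgroup) (auto simp: carrier_Aut_tree)
  then have "self_similar_group {..<k} (generate ?A S)"
    using section_mem_generate[OF S] by (simp add: self_similar_group_def)
  moreover have "finite (generate ?A {s \<in> S. x \<in> inactive_pegs k s})" if "x < k" for x
    using that by (intro fin) (auto simp: essential_set_def)
  then have "finite ?N" by blast
  moreover have "?N \<subseteq> generate ?A S"
    by (intro UN_least Aut.mono_generate) auto
  moreover have "\<exists>n. \<forall>v\<in>lists {..<k}. n \<le> length v \<longrightarrow> word_section {..<k} g v \<in> ?N"
    if g: "g \<in> generate ?A S" for g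
  proof -
    obtain ws where ws: "g = word_product {..<k} ws"
      and letters: "\<forall>a\<in>set ws. a \<in> hanoi_automorphisms k \<and>
        (\<exists>s\<in>S. a \<in> generate ?A {s} \<and> inactive_pegs k a = inactive_pegs k s)"
      using hanoi_generate_word[OF S g] by blast
    have "word_section {..<k} g v \<in> ?N" if "v \<in> lists {..<k}" "length ws \<le> length v" for v
      unfolding ws using bspec[OF letters] that by (rule word_section_mem_nucleus[OF S k])
    then show ?thesis by blast
  qed
  ultimately show ?thesis
    unfolding contracting_def by (intro conjI exI[of _ ?N] ballI)
qed

theorem theorem4p2:
  fixes k :: nat and G S :: "(nat list \<Rightarrow> nat list) set"
  assumes "k \<ge> 3"
    and "hanoi_group k G S"
  shows "contracting {..<k} G \<longleftrightarrow>
    (\<forall>T j. T \<subseteq> S \<and> finite T \<and> essential_set k T \<noteq> {} \<and> j \<in> {..<k} \<and> j \<notin> fixed_pegs k T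
       \<longrightarrow> (\<exists>s\<in>T. peg_orbit k T j \<inter> inactive_pegs k s = {}))"
    (is "_ \<longleftrightarrow> ?orbit_condition")
proof
  have S: "S \<subseteq> hanoi_automorphisms k" and G: "G = generate (Aut_tree {..<k}) S"
    using assms(2) by (auto simp: hanoi_group_def)
  show ?orbit_condition if contr: "contracting {..<k} G"
  proof (intro allI impI, elim conjE)
    fix T j
    assume T: "T \<subseteq> S" and e: "essential_set k T \<noteq> {}" and j: "j \<in> {..<k}" "j \<notin> fixed_pegs k T"
    have "finite (generate (Aut_tree {..<k}) T)"
      using T S G e Aut.mono_generate[OF T] by (intro finite_generate_of_contracting[OF contr _ _ e]) auto
    then show "\<exists>s\<in>T. peg_orbit k T j \<inter> inactive_pegs k s = {}"
      using T S j by (intro orbit_avoids_inactive_pegs_of_finite_generate) auto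
  qed
  show "contracting {..<k} G" if cond: ?orbit_condition
    unfolding G
  proof (rule contracting_of_finite_generate[OF _ S])
    show "0 < k" using assms(1) by simp
    fix T assume T: "T \<subseteq> S" and e: "essential_set k T \<noteq> {}"
    have fin: "finite T'" if "T' \<subseteq> T" for T'
      using that T S finite_subset[OF _ finite_hanoi_automorphisms] by blast
    show "finite (generate (Aut_tree {..<k}) T)"
    proof (rule finite_generate_of_orbit_condition[OF _ e])
      show "T \<subseteq> hanoi_automorphisms k" using T S by blast
      show "\<exists>s\<in>T'. peg_orbit k T' j \<inter> inactive_pegs k s = {}"
        if "T' \<subseteq> T" "essential_set k T' \<noteq> {}" "j < k" "j \<notin> fixed_pegs k T'" for T' j
        using cond that fin[OF that(1)] T by blast
    qed
  qed
qed

end
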